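(* If $G$ is a countable group which has a Cayley graph of infinite diameter (i.e., there is a generating set $S$ of $G$ such that the word length with respect to $S$ is unbounded on $G$), then $G$ is weakly amenable.
   Context: A countable group $G$ is weakly amenable if either $G$ is finite, or there is an equivalence relation $\sim$ on $G$ such that (1) $G/\!\sim$ is infinite, (2) for every $g\in G$ there is $b(g)\in\mathbb{N}$ such that for every class $C\in G/\!\sim$, $|\{C'\in G/\!\sim: gC\cap C'\neq\emptyset\}|\le b(g)$; and there is an increasing sequence of finite sets $A_n\subseteq G/\!\sim$ with $\bigcup_n A_n=G/\!\sim$ such that for every $g\in G$, $\lim_{n\to\infty}|\{C\in A_n: gC\subseteq \bigcup A_n\}|/|A_n|=1$, where $\bigcup A_n$ is the union of the classes in $A_n$. *)

theory Defs
  imports "HOL-Algebra.Generated_Groups" "HOL-Library.Countable_Set" Complex_Main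
begin

definition word_length :: "('a, 'b) monoid_scheme \<Rightarrow> 'a set \<Rightarrow> 'a \<Rightarrow> nat" where
  "word_length G S g =
     (LEAST n. \<exists>w. set w \<subseteq> S \<union> m_inv G ` S \<and> length w = n \<and>
        foldr (\<otimes>\<^bsub>G\<^esub>) w \<one>\<^bsub>G\<^esub> = g)"

text \<open>\<^const>\<open>word_length\<close> is the distance from the identity in the Cayley graph of \<open>G\<close> with
  respect to \<open>S\<close>. The value is meaningful only for elements of \<open>generate G S\<close>, hence the
  requirement that \<open>S\<close> generates \<open>G\<close>. The generating set \<open>S\<close> may be infinite.\<close>

definition has_infinite_diameter_Cayley_graph :: "('a, 'b) monoid_scheme \<Rightarrow> bool" where
  "has_infinite_diameter_Cayley_graph G \<longleftrightarrow>
     (\<exists>S. S \<subseteq> carrier G \<and> generate G S = carrier G \<and>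
        (\<forall>n. \<exists>g\<in>carrier G. n < word_length G S g))"

text \<open>The finiteness conjunct in the second condition is needed because \<^const>\<open>card\<close> is \<open>0\<close> on
  infinite sets.\<close>

definition weakly_amenable :: "('a, 'b) monoid_scheme \<Rightarrow> bool" where
  "weakly_amenable G \<longleftrightarrow>
     finite (carrier G) \<or>
     (\<exists>r. equiv (carrier G) r \<and>
        infinite (carrier G // r) \<and>
        (\<forall>g\<in>carrier G. \<exists>b::nat. \<forall>C\<in>carrier G // r.
           finite {C' \<in> carrier G // r. (g <#\<^bsub>G\<^esub> C) \<inter> C' \<noteq> {}} \<and>
           card {C' \<in> carrier G // r. (g <#\<^bsub>G\<^esub> C) \<inter> C' \<noteq> {}} \<le> b) \<and>
        (\<exists>A :: nat \<Rightarrow> 'a set set.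
           incseq A \<and>
           (\<forall>n. finite (A n)) \<and>
           (\<Union>n. A n) = carrier G // r \<and>
           (\<forall>g\<in>carrier G.
              (\<lambda>n. real (card {C \<in> A n. g <#\<^bsub>G\<^esub> C \<subseteq> \<Union> (A n)}) / real (card (A n)))
                \<longlonglongrightarrow> 1)))"

end

theory Submission
  imports Defs
begin

text \<open>The classes are the spheres of the Cayley graph, so the quotient is the set of natural numbers.
  Left multiplication by \<open>g\<close> moves the word length by at most a constant \<open>c\<close> depending only on \<open>g\<close>;
  hence it spreads a sphere over at most \<open>2 * c + 1\<close> spheres, and it moves at most \<open>c\<close> of the
  \<open>n + 1\<close> spheres of the ball of radius \<open>n\<close> out of that ball.\<close>

context group
begin

lemma foldr_mult_closed:
  "set w \<subseteq> carrier G \<Longrightarrow> foldr (\<otimes>) w \<one> \<in> carrier G"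
  by (induction w) auto

lemma foldr_mult_append:
  "set u \<subseteq> carrier G \<Longrightarrow> set v \<subseteq> carrier G \<Longrightarrow>
    foldr (\<otimes>) (u @ v) \<one> = foldr (\<otimes>) u \<one> \<otimes> foldr (\<otimes>) v \<one>"
proof (induction u)
  case (Cons a u)
  then show ?case
    using foldr_mult_closed[of u] foldr_mult_closed[of v] by (auto simp: m_assoc simp del: foldr_append)
qed (auto simp: foldr_mult_closed)

text \<open>This makes the minimum in \<open>word_length\<close> range over a nonempty set, so that
  it is attained by a geodesic word. Inverses of generators are letters, so each constructor of
  \<open>generate\<close> translates directly, with products becoming concatenations.\<close>

lemma generate_imp_word:
  assumes "S \<subseteq> carrier G" and "g \<in> generate G S"
  shows "\<exists>w. set w \<subseteq> S \<union> m_inv G ` S \<and> foldr (\<otimes>) w \<one> = g"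
  using assms(2)
proof (induction rule: generate.induct)
  case one
  then show ?case by (intro exI[of _ "[]"]) auto
next
  case (incl h)
  then show ?case using assms(1) by (intro exI[of _ "[h]"]) auto
next
  case (inv h)
  then show ?case using assms(1) by (intro exI[of _ "[inv h]"]) auto
next
  case (eng h1 h2)
  then obtain u v where
    "set u \<subseteq> S \<union> m_inv G ` S" "foldr (\<otimes>) u \<one> = h1"
    "set v \<subseteq> S \<union> m_inv G ` S" "foldr (\<otimes>) v \<one> = h2"
    by blast
  moreover have "S \<union> m_inv G ` S \<subseteq> carrier G" using assms(1) by auto
  ultimately show ?case
    using foldr_mult_append[of u v] by (intro exI[of _ "u @ v"]) auto
qed

lemma word_length_le:
  assumes "set w \<subseteq> S \<union> m_inv G ` S"
  shows "word_length G S (foldr (\<otimes>) w \<one>) \<le> length w"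
  unfolding word_length_def using assms by (intro Least_le) blast

lemma geodesic_word_exists:
  assumes "S \<subseteq> carrier G" and "g \<in> generate G S"
  obtains w where "set w \<subseteq> S \<union> m_inv G ` S" "length w = word_length G S g"
    "foldr (\<otimes>) w \<one> = g"
proof -
  let ?P = "\<lambda>n. \<exists>w. set w \<subseteq> S \<union> m_inv G ` S \<and> length w = n \<and> foldr (\<otimes>) w \<one> = g"
  have "\<exists>n. ?P n" using generate_imp_word[OF assms] by blast
  then have "?P (word_length G S g)"
    unfolding word_length_def by (rule LeastI_ex)
  then show thesis using that by blast
qed

text \<open>Concatenating geodesic words for \<open>g\<close> and \<open>h\<close> spells the
  product; the resulting word need not be geodesic, hence only an inequality.\<close>

lemma word_length_mult_le:
  assumes "S \<subseteq> carrier G" and "g \<in> generate G S" and "h \<in> generate G S"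
  shows "word_length G S (g \<otimes> h) \<le> word_length G S g + word_length G S h"
proof -
  obtain u where u: "set u \<subseteq> S \<union> m_inv G ` S" "length u = word_length G S g"
    "foldr (\<otimes>) u \<one> = g"
    using geodesic_word_exists[OF assms(1,2)] .
  obtain v where v: "set v \<subseteq> S \<union> m_inv G ` S" "length v = word_length G S h"
    "foldr (\<otimes>) v \<one> = h"
    using geodesic_word_exists[OF assms(1,3)] .
  have "S \<union> m_inv G ` S \<subseteq> carrier G" using assms(1) by auto
  with u v have "foldr (\<otimes>) (u @ v) \<one> = g \<otimes> h"
    using foldr_mult_append[of u v] by auto
  with word_length_le[of "u @ v" S] u v show ?thesis by auto
qed

text \<open>A suffix of a geodesic word is geodesic, since a shorter spelling of it would shorten
  the whole word. The suffix with \<open>n\<close> letters thus represents an element of length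
  exactly \<open>n\<close>.\<close>

lemma word_length_attains_smaller:
  assumes S: "S \<subseteq> carrier G" and gen: "generate G S = carrier G"
    and g: "g \<in> carrier G" and n: "n \<le> word_length G S g"
  shows "\<exists>h\<in>carrier G. word_length G S h = n"
proof -
  obtain w where w: "set w \<subseteq> S \<union> m_inv G ` S" "length w = word_length G S g"
    "foldr (\<otimes>) w \<one> = g"
    using geodesic_word_exists[OF S, of g] g gen by auto
  define k where "k = length w - n"
  define u where "u = take k w"
  define v where "v = drop k w"
  have wuv: "w = u @ v" and lens: "length u = k" "length v = n" "k + n = word_length G S g"
    using n w(2) by (auto simp: u_def v_def k_def)
  have sub: "set u \<subseteq> S \<union> m_inv G ` S" "set v \<subseteq> S \<union> m_inv G ` S"
    using w(1) wuv by auto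
  have "S \<union> m_inv G ` S \<subseteq> carrier G" using S by auto
  with sub have carr: "set u \<subseteq> carrier G" "set v \<subseteq> carrier G" by auto
  let ?u = "foldr (\<otimes>) u \<one>" and ?v = "foldr (\<otimes>) v \<one>"
  have "g = ?u \<otimes> ?v"
    using w(3) foldr_mult_append[OF carr] wuv by simp
  then have "word_length G S g \<le> word_length G S ?u + word_length G S ?v"
    using word_length_mult_le[OF S, of ?u ?v] carr foldr_mult_closed gen by simp
  \<comment> \<open>The prefix has length at most \<open>k\<close> and the suffix at most
    \<open>n\<close>, while their sum is at least \<open>k + n\<close>; so both bounds are
    equalities.\<close>
  with word_length_le[OF sub(1)] word_length_le[OF sub(2)] lens
  have "word_length G S ?v = n" by linarith
  then show ?thesis using foldr_mult_closed[OF carr(2)] by blast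
qed

text \<open>Subadditivity controls how far a translation moves the level sets of \<open>l\<close>.
  Surjectivity makes every level set nonempty, so the classes correspond bijectively to the natural
  numbers.\<close>

lemma weakly_amenable_if_subadditive_length:
  fixes l :: "'a \<Rightarrow> nat"
  assumes subadd: "\<And>g h. g \<in> carrier G \<Longrightarrow> h \<in> carrier G \<Longrightarrow> l (g \<otimes> h) \<le> l g + l h"
    and surj: "l ` carrier G = UNIV"
  shows "weakly_amenable G"
proof -
  define r where "r = {(x, y). x \<in> carrier G \<and> y \<in> carrier G \<and> l x = l y}"
  define sphere where "sphere i = {x \<in> carrier G. l x = i}" for i
  \<comment> \<open>The summand \<open>l g\<close> bounds the increase of \<open>l\<close> under
    translation by \<open>g\<close>, and \<open>l (inv g)\<close> the decrease; their sum serves for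
    both, as \<open>l\<close> is not assumed symmetric.\<close>
  define c where "c g = l g + l (inv g)" for g
  define A where "A n = sphere ` {..n}" for n
  have equiv: "equiv (carrier G) r"
    by (rule equivI) (auto simp: r_def refl_on_def sym_def trans_def)
  have r_class: "r `` {x} = sphere (l x)" if "x \<in> carrier G" for x
    using that by (auto simp: r_def sphere_def)
  have "carrier G // r = sphere ` l ` carrier G"
    by (auto simp: quotient_def r_class)
  then have quot: "carrier G // r = range sphere" by (simp add: surj)
  have nonempty: "\<exists>x\<in>carrier G. l x = i" for i
    using surj by (metis UNIV_I imageE)
  \<comment> \<open>A common element of two equal spheres has both indices as its length;
    nonemptiness provides such an element.\<close>
  have inj: "inj sphere"
  proof (rule injI)
    fix i j assume "sphere i = sphere j"
    with nonempty[of i] show "i = j" by (auto simp: sphere_def)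
  qed
  have upper: "l (g \<otimes> x) \<le> l x + c g" if "g \<in> carrier G" "x \<in> carrier G" for g x
    using subadd[OF that] by (simp add: c_def)
  have lower: "l x \<le> l (g \<otimes> x) + c g" if "g \<in> carrier G" "x \<in> carrier G" for g x
  proof -
    have "x = inv g \<otimes> (g \<otimes> x)" using that by (simp add: m_assoc[symmetric])
    then have "l x \<le> l (inv g) + l (g \<otimes> x)"
      using subadd[of "inv g" "g \<otimes> x"] that by simp
    then show ?thesis by (simp add: c_def)
  qed
  have spread: "finite {C' \<in> carrier G // r. (g <# C) \<inter> C' \<noteq> {}} \<and>
      card {C' \<in> carrier G // r. (g <# C) \<inter> C' \<noteq> {}} \<le> 2 * c g + 1"
    (is "finite ?M \<and> card ?M \<le> _")
    if g: "g \<in> carrier G" and C: "C \<in> carrier G // r" for g C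
  proof -
    obtain i where i: "C = sphere i" using C quot by auto
    \<comment> \<open>Truncation of \<open>i - c g\<close> at 0 is harmless: no sphere has a
      negative index, and the interval only gets shorter.\<close>
    have sub: "?M \<subseteq> sphere ` {i - c g..i + c g}"
    proof
      fix C' assume "C' \<in> ?M"
      then obtain j x where j: "C' = sphere j" and x: "x \<in> carrier G" "l x = i" "l (g \<otimes> x) = j"
        using quot i by (auto simp: l_coset_def sphere_def)
      have "j \<in> {i - c g..i + c g}" using upper[OF g x(1)] lower[OF g x(1)] x by auto
      with j show "C' \<in> sphere ` {i - c g..i + c g}" by blast
    qed
    have "card ?M \<le> card (sphere ` {i - c g..i + c g})" by (rule card_mono[OF _ sub]) simp
    also have "\<dots> \<le> card {i - c g..i + c g}" by (rule card_image_le) simp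
    also have "\<dots> \<le> 2 * c g + 1" by simp
    finally show ?thesis using finite_subset[OF sub] by simp
  qed
  have cardA: "card (A n) = n + 1" for n
    unfolding A_def using inj by (subst card_image) (auto intro: inj_on_subset)
  have lim: "(\<lambda>n. real (card {C \<in> A n. g <# C \<subseteq> \<Union> (A n)}) / real (card (A n))) \<longlonglongrightarrow> 1"
    (is "?f \<longlonglongrightarrow> 1") if g: "g \<in> carrier G" for g
  proof (rule tendsto_sandwich)
    \<comment> \<open>Stated additively, the bound also covers small \<open>n\<close> with
      \<open>n + 1 < c g\<close>, where it is trivial.\<close>
    have good: "n + 1 \<le> card {C \<in> A n. g <# C \<subseteq> \<Union> (A n)} + c g" for n
    proof -
      \<comment> \<open>These are the spheres whose index \<open>i\<close> satisfies
        \<open>i + c g \<le> n\<close>, so that \<open>upper\<close> keeps their translates within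
        length \<open>n\<close>.\<close>
      have "sphere ` {..<n + 1 - c g} \<subseteq> {C \<in> A n. g <# C \<subseteq> \<Union> (A n)}"
      proof
        fix C assume "C \<in> sphere ` {..<n + 1 - c g}"
        then obtain i where i: "C = sphere i" "i + c g \<le> n" by auto
        have "g \<otimes> x \<in> sphere (l (g \<otimes> x))" "l (g \<otimes> x) \<le> n" if "x \<in> sphere i" for x
          using that upper[OF g, of x] i g by (auto simp: sphere_def)
        then have "g <# C \<subseteq> \<Union> (A n)" unfolding i(1) l_coset_def A_def by blast
        then show "C \<in> {C \<in> A n. g <# C \<subseteq> \<Union> (A n)}" using i by (auto simp: A_def)
      qed
      then have "card (sphere ` {..<n + 1 - c g}) \<le> card {C \<in> A n. g <# C \<subseteq> \<Union> (A n)}"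
        by (intro card_mono) (auto simp: A_def)
      moreover have "card (sphere ` {..<n + 1 - c g}) = n + 1 - c g"
        using inj by (subst card_image) (auto intro: inj_on_subset)
      ultimately show ?thesis by simp
    qed
    \<comment> \<open>The lower side of the sandwich is \<open>good\<close> divided by the
      \<open>n + 1\<close> spheres of \<open>A n\<close>; the upper side is the constant 1.\<close>
    show "\<forall>\<^sub>F n in sequentially. 1 - real (c g) / real (Suc n) \<le> ?f n"
    proof (intro always_eventually allI)
      fix n
      have "real (Suc n) - real (c g) \<le> real (card {C \<in> A n. g <# C \<subseteq> \<Union> (A n)})"
        using good[of n] by linarith
      then have "(real (Suc n) - real (c g)) / real (Suc n) \<le> ?f n"
        unfolding cardA Suc_eq_plus1 by (rule divide_right_mono) simp
      then show "1 - real (c g) / real (Suc n) \<le> ?f n"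
        by (simp add: diff_divide_distrib)
    qed
    have "card {C \<in> A n. g <# C \<subseteq> \<Union> (A n)} \<le> card (A n)" for n
      by (intro card_mono) (auto simp: A_def)
    then show "\<forall>\<^sub>F n in sequentially. ?f n \<le> 1"
      by (intro always_eventually allI divide_le_eq_1_pos[THEN iffD2])
        (simp_all add: cardA del: of_nat_Suc)
    have "(\<lambda>n. 1 - real (c g) / real (Suc n)) \<longlonglongrightarrow> 1 - 0"
      by (rule tendsto_diff[OF tendsto_const LIMSEQ_Suc[OF lim_const_over_n]])
    then show "(\<lambda>n. 1 - real (c g) / real (Suc n)) \<longlonglongrightarrow> 1" by simp
  qed (rule tendsto_const)
  have "\<forall>g\<in>carrier G. \<exists>b::nat. \<forall>C\<in>carrier G // r.
      finite {C' \<in> carrier G // r. (g <# C) \<inter> C' \<noteq> {}} \<and>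
      card {C' \<in> carrier G // r. (g <# C) \<inter> C' \<noteq> {}} \<le> b"
    using spread by blast
  moreover have "infinite (carrier G // r)"
    unfolding quot using inj by (rule range_inj_infinite)
  moreover have "incseq A" by (auto simp: incseq_def A_def)
  moreover have "\<forall>n. finite (A n)" by (simp add: A_def)
  moreover have "(\<Union>n. A n) = carrier G // r" by (auto simp: quot A_def)
  ultimately show ?thesis
    unfolding weakly_amenable_def using equiv lim
    by (intro disjI2 exI[of _ r] exI[of _ A] conjI) simp_all
qed

end

theorem theorem3p4:
  fixes G :: "('a, 'b) monoid_scheme"
  assumes "group G"
    and "countable (carrier G)"
    and "has_infinite_diameter_Cayley_graph G"
  shows "weakly_amenable G"
proof -
  interpret group G by fact
  obtain S where S: "S \<subseteq> carrier G" "generate G S = carrier G"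
    and unbounded: "\<And>n. \<exists>g\<in>carrier G. n < word_length G S g"
    using assms(3) unfolding has_infinite_diameter_Cayley_graph_def by blast
  show ?thesis
  proof (rule weakly_amenable_if_subadditive_length)
    show "word_length G S (g \<otimes>\<^bsub>G\<^esub> h) \<le> word_length G S g + word_length G S h"
      if "g \<in> carrier G" "h \<in> carrier G" for g h
      using word_length_mult_le[OF S(1)] S(2) that by simp
    \<comment> \<open>Infinite diameter supplies an element longer than \<open>n\<close>; a suffix
      of its geodesic word has length \<open>n\<close>.\<close>
    have "n \<in> word_length G S ` carrier G" for n
    proof -
      obtain g where "g \<in> carrier G" "n < word_length G S g" using unbounded by blast
      then show ?thesis using word_length_attains_smaller[OF S, of g n] by auto
    qed
    then show "word_length G S ` carrier G = UNIV" by blast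
  qed
qed

end
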